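(* Let $f \colon \mathbb{R}^n \to \mathbb{R}$ be $L$-smooth and $\mu$-strongly convex with respect to the given inner product, with $0 < \mu \le L$, and let $x^*$ be its unique global minimizer. Let $x, d \in \mathbb{R}^n$ and $\theta \in [0,\pi/2)$ satisfy \[ \langle \nabla f(x), d\rangle = \cos\theta\, \|\nabla f(x)\|\,\|d\|, \] and assume that there are constants $0 < c_1 \le c_2$ and $\theta' \in [0,\pi/2)$ such that \[ \theta \le \theta', \qquad c_1\|\nabla f(x)\| \le \|d\| \le c_2 \|\nabla f(x)\|. \] Define \[ \bar h = \frac{2\cos\theta'}{L c_2(1+\sin\theta') + \mu c_1(1-\sin\theta')}. \] Then for $0 \le h \le \bar h$ the point $x^+ = x - hd$ satisfies \[ f(x^+) - f(x^* ) \le \left(1 - \frac{h\mu c_1(1-\sin\theta')}{\cos\theta'}\right)^2 (f(x) - f(x^* )). \] In particular, the step size $h = \bar h$ yields \[ f(x^+) - f(x^* ) \le \left(\frac{\kappa'-1}{\kappa'+1}\right)^2 (f(x) - f(x^* )), \qquad \kappa' = \frac{L}{\mu}\,\frac{c_2}{c_1}\left(\frac{1+\sin\theta'}{1-\sin\theta'}\right). \]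
   Context: $\mathbb{R}^n$ is equipped with an arbitrary fixed inner product $\langle \cdot,\cdot\rangle$ with corresponding norm $\|\cdot\|$, and $\nabla f$ denotes the gradient of the differentiable function $f$ with respect to this inner product. The function $f$ is $L$-smooth if $\|\nabla f(x) - \nabla f(y)\| \le L\|x-y\|$ for all $x,y \in \mathbb{R}^n$, and $\mu$-strongly convex if $f(x) \ge f(y) + \langle \nabla f(y), x-y\rangle + \frac{\mu}{2}\|x-y\|^2$ for all $x,y\in\mathbb{R}^n$. *)

theory Defs
  imports "HOL-Analysis.Analysis"
begin

text \<open>
  The inner product on \<open>\<real>\<^sup>n\<close> is an arbitrary one, passed as an explicit argument; it need not be
  the standard dot product that the library attaches to the type \<open>real ^ 'n\<close>.  Notions of topology
  and differentiability are the library's, since all norms on \<open>\<real>\<^sup>n\<close> are equivalent.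
\<close>

definition inner_product :: "('a::real_vector \<Rightarrow> 'a \<Rightarrow> real) \<Rightarrow> bool" where
  "inner_product ip \<longleftrightarrow>
     bilinear ip \<and> (\<forall>x y. ip x y = ip y x) \<and> (\<forall>x. x \<noteq> 0 \<longrightarrow> 0 < ip x x)"

definition ip_norm :: "('a::real_vector \<Rightarrow> 'a \<Rightarrow> real) \<Rightarrow> 'a \<Rightarrow> real" where
  "ip_norm ip x = sqrt (ip x x)"

text \<open>
  The gradient is the vector representing the Frechet derivative with respect to \<open>ip\<close>.  It exists and
  is unique where \<open>f\<close> is differentiable (in finite dimension); elsewhere the value is unspecified, so
  the notions below demand differentiability explicitly.
\<close>

definition gradient :: "('a::real_normed_vector \<Rightarrow> 'a \<Rightarrow> real) \<Rightarrow> ('a \<Rightarrow> real) \<Rightarrow> 'a \<Rightarrow> 'a" where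
  "gradient ip f x = (THE g. (f has_derivative (\<lambda>v. ip g v)) (at x))"

definition smooth_wrt :: "('a::real_normed_vector \<Rightarrow> 'a \<Rightarrow> real) \<Rightarrow> real \<Rightarrow> ('a \<Rightarrow> real) \<Rightarrow> bool" where
  "smooth_wrt ip L f \<longleftrightarrow>
     (\<forall>x. f differentiable (at x)) \<and>
     (\<forall>x y. ip_norm ip (gradient ip f x - gradient ip f y) \<le> L * ip_norm ip (x - y))"

definition strongly_convex_wrt ::
    "('a::real_normed_vector \<Rightarrow> 'a \<Rightarrow> real) \<Rightarrow> real \<Rightarrow> ('a \<Rightarrow> real) \<Rightarrow> bool" where
  "strongly_convex_wrt ip \<mu> f \<longleftrightarrow>
     (\<forall>x. f differentiable (at x)) \<and>
     (\<forall>x y. f x \<ge> f y + ip (gradient ip f y) (x - y) + \<mu> / 2 * (ip_norm ip (x - y))\<^sup>2)"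

end

theory Submission
  imports Defs
begin

text \<open>
  The search direction \<open>d\<close> is an exact gradient, only for a different inner product.  With
  \<open>g = \<nabla>f(x)\<close> and \<open>r = \<parallel>d\<parallel> / \<parallel>g\<parallel>\<close>, the vector \<open>w = (cos \<theta> / r) d - g\<close> has norm
  \<open>sin \<theta> \<parallel>g\<parallel>\<close>, so some reflection \<open>R\<close> sends \<open>sin \<theta> g\<close> to \<open>w\<close>.  Hence the positive definite
  operator \<open>B = (r / cos \<theta>) (I + sin \<theta> R)\<close> satisfies \<open>B g = d\<close>, and its spectrum lies in
  \<open>[r (1 - sin \<theta>) / cos \<theta>, r (1 + sin \<theta>) / cos \<theta>]\<close>.  For the inner product
  \<open>\<langle>B\<^sup>-\<^sup>1 u, v\<rangle>\<close> the gradient of \<open>f\<close> at \<open>x\<close> is \<open>d\<close>, and passing to it multiplies the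
  strong convexity and smoothness constants by the ends of that interval (lemma
  \<open>preconditioned_inner_product\<close>).  Enlarging the interval to the one determined by \<open>\<theta>'\<close>, \<open>c\<^sub>1\<close>
  and \<open>c\<^sub>2\<close> gives constants \<open>m \<le> M\<close> with \<open>hbar = 2 / (M + m)\<close> and \<open>\<kappa>' = M / m\<close>.  If \<open>g = 0\<close>, then
  \<open>d = 0\<close> and \<open>x\<close> is already the minimizer.

  It remains to show that an exact gradient step of length \<open>h \<le> 2 / (M + m)\<close> contracts the
  suboptimality by the factor \<open>(1 - h m)\<^sup>2\<close> (lemma \<open>gradient_step_contraction\<close>).  This is a
  combination of three instances of \<open>interpolation_inequality\<close>, which relates values and gradients
  at two points of a function squeezed between quadratics of curvatures \<open>m\<close> and \<open>M\<close>.  Smoothness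
  is used only through the quadratic upper bound, because a bound by a quadratic form, unlike
  Lipschitz continuity of the gradient, passes at once from one inner product to another.
\<close>

section \<open>Arbitrary inner products\<close>

lemma inner_product_algebra:
  assumes "inner_product ip"
  shows "ip (u + v) w = ip u w + ip v w" "ip w (u + v) = ip w u + ip w v"
    "ip (u - v) w = ip u w - ip v w" "ip w (u - v) = ip w u - ip w v"
    "ip (a *\<^sub>R u) w = a * ip u w" "ip w (a *\<^sub>R u) = a * ip w u"
    "ip (- u) w = - ip u w" "ip w (- u) = - ip w u"
    "ip 0 w = 0" "ip w 0 = 0"
proof -
  have "bilinear ip"
    using assms by (simp add: inner_product_def)
  then show "ip (u + v) w = ip u w + ip v w" "ip w (u + v) = ip w u + ip w v"
    "ip (u - v) w = ip u w - ip v w" "ip w (u - v) = ip w u - ip w v"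
    "ip (a *\<^sub>R u) w = a * ip u w" "ip w (a *\<^sub>R u) = a * ip w u"
    "ip (- u) w = - ip u w" "ip w (- u) = - ip w u"
    "ip 0 w = 0" "ip w 0 = 0"
    by (simp_all add: bilinear_ladd bilinear_radd bilinear_lsub bilinear_rsub bilinear_lmul
        bilinear_rmul bilinear_lneg bilinear_rneg bilinear_lzero bilinear_rzero)
qed

lemma inner_product_commute: "inner_product ip \<Longrightarrow> ip u v = ip v u"
  by (simp add: inner_product_def)

lemma inner_product_pos: "inner_product ip \<Longrightarrow> u \<noteq> 0 \<Longrightarrow> 0 < ip u u"
  by (simp add: inner_product_def)

lemma inner_product_nonneg: "inner_product ip \<Longrightarrow> 0 \<le> ip u u"
  by (cases "u = 0") (simp_all add: inner_product_algebra inner_product_pos less_imp_le)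

lemma inner_product_eq_0_iff: "inner_product ip \<Longrightarrow> ip u u = 0 \<longleftrightarrow> u = 0"
  by (cases "u = 0") (simp_all add: inner_product_algebra inner_product_pos less_imp_neq[symmetric])

lemma ip_norm_power2: "inner_product ip \<Longrightarrow> (ip_norm ip u)\<^sup>2 = ip u u"
  by (simp add: ip_norm_def inner_product_nonneg)

lemma ip_norm_nonneg: "inner_product ip \<Longrightarrow> 0 \<le> ip_norm ip u"
  by (simp add: ip_norm_def inner_product_nonneg)

lemma ip_norm_eq_0_iff: "inner_product ip \<Longrightarrow> ip_norm ip u = 0 \<longleftrightarrow> u = 0"
  by (simp add: ip_norm_def inner_product_eq_0_iff)

lemma ip_norm_scaleR: "inner_product ip \<Longrightarrow> ip_norm ip (t *\<^sub>R u) = \<bar>t\<bar> * ip_norm ip u"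
  by (simp add: ip_norm_def inner_product_algebra real_sqrt_mult flip: mult.assoc)

lemma ip_Cauchy_Schwarz:
  assumes ip: "inner_product ip"
  shows "ip u v \<le> ip_norm ip u * ip_norm ip v"
proof (cases "v = 0")
  case True
  with ip show ?thesis by (simp add: inner_product_algebra ip_norm_def)
next
  case False
  then have pos: "0 < ip v v"
    using ip by (rule inner_product_pos[rotated])
  let ?e = "ip v v *\<^sub>R u - ip u v *\<^sub>R v"
  have "0 \<le> ip ?e ?e"
    by (rule inner_product_nonneg[OF ip])
  also have "ip ?e ?e = ip v v * (ip u u * ip v v - (ip u v)\<^sup>2)"
    by (simp add: inner_product_algebra[OF ip] inner_product_commute[OF ip, of v u]
        power2_eq_square algebra_simps)
  finally have "(ip u v)\<^sup>2 \<le> ip u u * ip v v"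
    using pos by (simp add: zero_le_mult_iff)
  then have "ip u v \<le> sqrt (ip u u * ip v v)"
    by (rule real_le_rsqrt)
  then show ?thesis
    by (simp add: ip_norm_def real_sqrt_mult)
qed

section \<open>Gradients with respect to an inner product\<close>

text \<open>
  Riesz representation: sending \<open>g\<close> to the coordinates of \<open>\<langle>g, \<cdot>\<rangle>\<close> on a basis is an injective
  endomorphism of a finite-dimensional space, hence onto.
\<close>

lemma inner_product_represents_linear:
  fixes ip :: "'a::euclidean_space \<Rightarrow> 'a \<Rightarrow> real"
  assumes ip: "inner_product ip" and D: "linear D"
  shows "\<exists>g. \<forall>v. D v = ip g v"
proof -
  note alg = inner_product_algebra[OF ip]
  define T where "T g = (\<Sum>b\<in>Basis. ip g b *\<^sub>R b)" for g :: 'a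
  have lin_ip: "linear (ip g)" for g
    by (rule linearI) (simp_all add: alg)
  have coord: "T g \<bullet> b = ip g b" if "b \<in> Basis" for g b
    using that by (simp add: T_def inner_sum_left inner_Basis if_distrib sum.delta cong: if_cong)
  have lin: "linear T"
    by (rule linearI; rule euclidean_eqI) (simp_all add: coord alg inner_add_left)
  have "g = 0" if "T g = 0" for g
  proof -
    have "ip g = (\<lambda>v. 0)"
    proof (rule linear_eq_stdbasis[OF lin_ip])
      show "linear (\<lambda>v::'a. 0::real)"
        by (rule linearI) simp_all
      show "ip g b = 0" if "b \<in> Basis" for b
        using coord[OF that, of g] \<open>T g = 0\<close> by simp
    qed
    then show ?thesis
      by (metis inner_product_eq_0_iff[OF ip])
  qed
  then have "inj T"
    using lin by (simp add: linear_injective_0)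
  then have "surj T"
    using lin by (simp add: linear_inj_imp_surj)
  then obtain g where g: "T g = (\<Sum>b\<in>Basis. D b *\<^sub>R b)"
    by (metis surjD)
  have "D = ip g"
  proof (rule linear_eq_stdbasis[OF D lin_ip])
    show "D b = ip g b" if "b \<in> Basis" for b
      using coord[OF that, of g] that unfolding g
      by (simp add: inner_sum_left inner_Basis if_distrib sum.delta cong: if_cong)
  qed
  then show ?thesis by auto
qed

lemma has_derivative_gradient:
  fixes ip :: "'a::euclidean_space \<Rightarrow> 'a \<Rightarrow> real"
  assumes ip: "inner_product ip" and f: "f differentiable (at x)"
  shows "(f has_derivative ip (gradient ip f x)) (at x)"
proof -
  obtain D where D: "(f has_derivative D) (at x)"
    using f by (auto simp: differentiable_def)
  obtain g where g: "\<And>v. D v = ip g v"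
    using inner_product_represents_linear[OF ip has_derivative_linear[OF D]] by auto
  have fg: "(f has_derivative ip g) (at x)"
    using D g by (metis ext)
  have "g' = g" if "(f has_derivative ip g') (at x)" for g'
  proof -
    have "ip g' = ip g"
      by (rule has_derivative_unique[OF that fg])
    then have "ip (g' - g) (g' - g) = 0"
      by (simp add: inner_product_algebra[OF ip])
    then show ?thesis
      by (simp add: inner_product_eq_0_iff[OF ip])
  qed
  with fg have "gradient ip f x = g"
    unfolding gradient_def by (rule the_equality)
  with fg show ?thesis by simp
qed

text \<open>
  Along the segment from \<open>y\<close> to \<open>z\<close> the function minus its claimed quadratic upper bound has a
  nonpositive derivative, by the Lipschitz condition and the Cauchy--Schwarz inequality.
\<close>

lemma smooth_wrt_quadratic_upper_bound:
  fixes ip :: "'a::euclidean_space \<Rightarrow> 'a \<Rightarrow> real"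
  assumes ip: "inner_product ip" and smooth: "smooth_wrt ip L f"
  shows "f z \<le> f y + ip (gradient ip f y) (z - y) + L / 2 * ip (z - y) (z - y)"
proof -
  note alg = inner_product_algebra[OF ip]
  define v where "v = z - y"
  define \<psi> where
    "\<psi> t = f (y + t *\<^sub>R v) - t * ip (gradient ip f y) v - L / 2 * t\<^sup>2 * ip v v" for t :: real
  have deriv: "(\<psi> has_real_derivative
      ip (gradient ip f (y + t *\<^sub>R v)) v - ip (gradient ip f y) v - L * t * ip v v) (at t)" for t
  proof -
    have "f differentiable (at (y + t *\<^sub>R v))"
      using smooth by (simp add: smooth_wrt_def)
    then have fd: "(f has_derivative ip (gradient ip f (y + t *\<^sub>R v))) (at (y + t *\<^sub>R v))"
      by (rule has_derivative_gradient[OF ip])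
    have "((\<lambda>t. y + t *\<^sub>R v) has_derivative (\<lambda>s. s *\<^sub>R v)) (at t)"
      by (auto intro!: derivative_eq_intros)
    from has_derivative_compose[OF this fd]
    have "((\<lambda>t. f (y + t *\<^sub>R v)) has_real_derivative ip (gradient ip f (y + t *\<^sub>R v)) v) (at t)"
      by (simp add: has_field_derivative_def alg mult.commute[of _ "ip _ v"])
    then show ?thesis
      unfolding \<psi>_def by (auto intro!: derivative_eq_intros)
  qed
  have nonpos: "ip (gradient ip f (y + t *\<^sub>R v)) v - ip (gradient ip f y) v - L * t * ip v v \<le> 0"
    if "0 \<le> t" for t
  proof -
    let ?e = "gradient ip f (y + t *\<^sub>R v) - gradient ip f y"
    have "ip_norm ip ?e \<le> L * ip_norm ip ((y + t *\<^sub>R v) - y)"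
      using smooth unfolding smooth_wrt_def by blast
    then have "ip_norm ip ?e \<le> L * t * ip_norm ip v"
      using that by (simp add: ip_norm_scaleR[OF ip])
    then have "ip_norm ip ?e * ip_norm ip v \<le> L * t * ip_norm ip v * ip_norm ip v"
      by (intro mult_right_mono ip_norm_nonneg[OF ip])
    also have "\<dots> = L * t * ip v v"
      by (simp add: power2_eq_square flip: ip_norm_power2[OF ip])
    finally have "ip ?e v \<le> L * t * ip v v"
      using ip_Cauchy_Schwarz[OF ip, of ?e v] by linarith
    then show ?thesis by (simp add: alg)
  qed
  have "\<psi> 1 \<le> \<psi> 0"
    by (rule DERIV_nonpos_imp_nonincreasing[of 0 1 \<psi>, OF zero_le_one])
       (use deriv nonpos in blast)
  then show ?thesis
    by (simp add: \<psi>_def v_def)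
qed

section \<open>Functions between two quadratics\<close>

text \<open>
  The quadratic lower bound at \<open>b\<close> and the upper bound at \<open>a\<close> are compared at the point where their
  difference is largest.
\<close>

lemma interpolation_inequality:
  fixes q :: "'a::real_vector \<Rightarrow> 'a \<Rightarrow> real"
  assumes q: "inner_product q" and "m < M"
    and lower: "\<And>y z. f y + q (G y) (z - y) + m / 2 * q (z - y) (z - y) \<le> f z"
    and upper: "\<And>y z. f z \<le> f y + q (G y) (z - y) + M / 2 * q (z - y) (z - y)"
  defines "e a b \<equiv> G a - G b - m *\<^sub>R (a - b)"
  shows "f b + q (G b) (a - b) + m / 2 * q (a - b) (a - b) + q (e a b) (e a b) / (2 * (M - m))
    \<le> f a"
proof -
  note alg = inner_product_algebra[OF q]
  define u where "u = a - b"
  define w where "w = (1 / (M - m)) *\<^sub>R e a b"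
  have e: "G a = e a b + G b + m *\<^sub>R u"
    by (simp add: e_def u_def)
  have ew: "e a b = (M - m) *\<^sub>R w"
    using \<open>m < M\<close> by (simp add: w_def)
  have "f b + q (G b) (u - w) + m / 2 * q (u - w) (u - w) \<le> f (a - w)"
    using lower[of b "a - w"] by (simp add: u_def algebra_simps)
  also have "f (a - w) \<le> f a - q (G a) w + M / 2 * q w w"
    using upper[of "a - w" a] by (simp add: alg)
  finally have "f b + q (G b) u + m / 2 * q u u + (M - m) * q w w / 2 \<le> f a"
    unfolding e ew by (simp add: alg inner_product_commute[OF q, of w u] field_simps)
  moreover have "(M - m) * q w w / 2 = q (e a b) (e a b) / (2 * (M - m))"
    unfolding ew using \<open>m < M\<close> by (simp add: alg field_simps)
  ultimately show ?thesis
    by (simp add: u_def)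
qed

text \<open>
  Write \<open>\<rho> = 1 - h m\<close>.  Raising \<open>M\<close> to \<open>2 / h - m\<close>, the value for which \<open>h\<close> is the longest
  admissible step, is harmless.  Then add the interpolation inequalities for the pairs
  \<open>(x, x\<^sup>+)\<close>, \<open>(x\<^sup>*, x\<^sup>+)\<close>, \<open>(x\<^sup>*, x)\<close> with weights \<open>\<rho>\<close>, \<open>1 - \<rho>\<close>, \<open>\<rho> (1 - \<rho>)\<close>: these are the
  weights for which the function values combine to \<open>f(x\<^sup>+) - f(x\<^sup>*) - \<rho>\<^sup>2 (f(x) - f(x\<^sup>*))\<close>, and what
  remains is a negative multiple of \<open>\<parallel>P + \<rho> p\<parallel>\<^sup>2\<close>, where \<open>p\<close> and \<open>P\<close> are the gradients at \<open>x\<close> and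
  \<open>x\<^sup>+\<close> of \<open>f\<close> minus its quadratic part \<open>m / 2 \<parallel>\<cdot> - x\<^sup>*\<parallel>\<^sup>2\<close>.  For \<open>\<rho> = 0\<close> the two quadratic bounds
  coincide, and the step reaches the minimum of the lower one.
\<close>

lemma gradient_step_contraction:
  fixes q :: "'a::real_vector \<Rightarrow> 'a \<Rightarrow> real"
  assumes q: "inner_product q" and "0 < m" and "m \<le> M"
    and lower: "\<And>y z. f y + q (G y) (z - y) + m / 2 * q (z - y) (z - y) \<le> f z"
    and upper: "\<And>y z. f z \<le> f y + q (G y) (z - y) + M / 2 * q (z - y) (z - y)"
    and min: "\<And>y. f xstar \<le> f y"
    and "0 \<le> h" and "h \<le> 2 / (M + m)"
  shows "f (x - h *\<^sub>R G x) - f xstar \<le> (1 - h * m)\<^sup>2 * (f x - f xstar)"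
proof -
  note alg = inner_product_algebra[OF q]
  define \<rho> where "\<rho> = 1 - h * m"
  have hMm: "h * (M + m) \<le> 2"
    using \<open>h \<le> 2 / (M + m)\<close> \<open>0 < m\<close> \<open>m \<le> M\<close> by (simp add: pos_le_divide_eq)
  moreover have "h * (m + m) \<le> h * (M + m)"
    using \<open>0 \<le> h\<close> \<open>m \<le> M\<close> by (intro mult_left_mono) auto
  ultimately have "h * (m + m) \<le> 2" by linarith
  then have "0 \<le> \<rho>"
    by (simp add: \<rho>_def algebra_simps)
  consider "h = 0" | "0 < h" "\<rho> = 0" | "0 < h" "0 < \<rho>"
    using \<open>0 \<le> h\<close> \<open>0 \<le> \<rho>\<close> by force
  then show ?thesis
  proof cases
    case 1
    then show ?thesis by simp
  next
    case 2
    then have h: "h = 1 / m"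
      using \<open>0 < m\<close> by (simp add: \<rho>_def field_simps)
    then have "M = m"
      using hMm \<open>m \<le> M\<close> \<open>0 < m\<close> unfolding h by (simp add: pos_divide_le_eq)
    define X where "X = xstar - x"
    have "f (x - h *\<^sub>R G x) \<le> f x - q (G x) (G x) / (2 * m)"
      using upper[of "x - h *\<^sub>R G x" x] \<open>M = m\<close> \<open>0 < m\<close>
      by (simp add: alg h power2_eq_square field_simps)
    also have "\<dots> \<le> f xstar"
    proof -
      have "0 \<le> q (G x + m *\<^sub>R X) (G x + m *\<^sub>R X) / (2 * m)"
        using \<open>0 < m\<close> by (simp add: inner_product_nonneg[OF q])
      also have "\<dots> = q (G x) (G x) / (2 * m) + q (G x) X + m / 2 * q X X"
        using \<open>0 < m\<close>
        by (simp add: alg inner_product_commute[OF q, of X "G x"] field_simps)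
      finally show ?thesis
        using lower[of x xstar] by (simp add: X_def)
    qed
    finally show ?thesis
      using \<open>\<rho> = 0\<close> by (simp add: \<rho>_def)
  next
    case 3
    define N where "N = 2 / h - m"
    have "M \<le> N"
      using hMm \<open>0 < h\<close> by (simp add: N_def field_simps)
    have K: "N - m = 2 * \<rho> / h"
      using \<open>0 < h\<close> by (simp add: N_def \<rho>_def field_simps)
    have "m < N"
    proof -
      have "0 < 2 * \<rho> / h" using 3 by simp
      then show ?thesis using K by linarith
    qed
    have upperN: "f z \<le> f y + q (G y) (z - y) + N / 2 * q (z - y) (z - y)" for y z
    proof -
      have "M / 2 * q (z - y) (z - y) \<le> N / 2 * q (z - y) (z - y)"
        using \<open>M \<le> N\<close> by (intro mult_right_mono inner_product_nonneg[OF q]) simp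
      then show ?thesis using upper[of z y] by linarith
    qed
    have Gstar: "G xstar = 0"
    proof -
      \<comment> \<open>a gradient step of length \<open>1 / M\<close> from the minimizer cannot decrease \<open>f\<close>\<close>
      have "f xstar \<le> f (xstar - (1 / M) *\<^sub>R G xstar)"
        by (rule min)
      also have "\<dots> \<le> f xstar - q (G xstar) (G xstar) / (2 * M)"
        using upper[of "xstar - (1 / M) *\<^sub>R G xstar" xstar] \<open>0 < m\<close> \<open>m \<le> M\<close>
        by (simp add: alg power2_eq_square field_simps)
      finally have "q (G xstar) (G xstar) \<le> 0"
        using \<open>0 < m\<close> \<open>m \<le> M\<close> by (simp add: divide_le_0_iff zero_le_divide_iff)
      then show ?thesis
        using inner_product_pos[OF q, of "G xstar"] by force
    qed
    define xp where "xp = x - h *\<^sub>R G x"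
    define X where "X = x - xstar"
    define p where "p = G x - m *\<^sub>R X"
    define P where "P = G xp - m *\<^sub>R (xp - xstar)"
    define k where "k = 1 / (2 * (N - m))"
    have "0 < k" using \<open>m < N\<close> by (simp add: k_def)
    have hk: "h = 4 * \<rho> * k"
      using K 3 by (simp add: k_def)
    have Gx: "G x = p + m *\<^sub>R X" by (simp add: p_def)
    have Xp: "xp - xstar = \<rho> *\<^sub>R X - h *\<^sub>R p"
      by (simp add: xp_def X_def p_def \<rho>_def algebra_simps)
    have Gxp: "G xp = P + m *\<^sub>R (\<rho> *\<^sub>R X - h *\<^sub>R p)"
      by (simp add: P_def Xp)
    have step: "x - xp = h *\<^sub>R (p + m *\<^sub>R X)"
      by (simp add: xp_def Gx)
    note interp = interpolation_inequality[OF q \<open>m < N\<close> lower upperN]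
    have diff1: "G x - G xp - m *\<^sub>R (x - xp) = p - P"
      by (simp add: p_def P_def X_def algebra_simps)
    have diff2: "G xstar - G xp - m *\<^sub>R (xstar - xp) = - P"
      by (simp add: Gstar P_def algebra_simps)
    have diff3: "G xstar - G x - m *\<^sub>R (xstar - x) = - p"
      by (simp add: Gstar p_def X_def algebra_simps)
    define A where
      "A = f xp + q (G xp) (x - xp) + m / 2 * q (x - xp) (x - xp) + k * q (p - P) (p - P)"
    define B where
      "B = f xp - q (G xp) (xp - xstar) + m / 2 * q (xp - xstar) (xp - xstar) + k * q P P"
    define C where "C = f x - q (G x) X + m / 2 * q X X + k * q p p"
    have A: "A \<le> f x"
      using interp[of xp x] unfolding diff1 by (simp add: A_def k_def)
    have B: "B \<le> f xstar"
      using interp[of xp xstar] unfolding diff2 by (simp add: alg B_def k_def algebra_simps)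
    have C: "C \<le> f xstar"
      using interp[of x xstar] unfolding diff3 by (simp add: alg C_def X_def k_def algebra_simps)
    have "\<rho> \<le> 1"
      using \<open>0 < h\<close> \<open>0 < m\<close> by (simp add: \<rho>_def)
    have "\<rho> * A \<le> \<rho> * f x"
      using A \<open>0 \<le> \<rho>\<close> by (rule mult_left_mono)
    moreover have "(1 - \<rho>) * B \<le> (1 - \<rho>) * f xstar"
      using B \<open>\<rho> \<le> 1\<close> by (intro mult_left_mono) auto
    moreover have "\<rho> * (1 - \<rho>) * C \<le> \<rho> * (1 - \<rho>) * f xstar"
      using C \<open>0 \<le> \<rho>\<close> \<open>\<rho> \<le> 1\<close> by (intro mult_left_mono) auto
    moreover have "\<rho> * A + (1 - \<rho>) * B + \<rho> * (1 - \<rho>) * C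
        = f xp + \<rho> * (1 - \<rho>) * f x + k * q (P + \<rho> *\<^sub>R p) (P + \<rho> *\<^sub>R p)"
    proof -
      \<comment> \<open>the last summand vanishes; with it, the identity is polynomial after \<open>\<rho> = 1 - h m\<close>\<close>
      have "\<rho> * A + (1 - \<rho>) * B + \<rho> * (1 - \<rho>) * C
          = f xp + \<rho> * (1 - \<rho>) * f x + k * q (P + \<rho> *\<^sub>R p) (P + \<rho> *\<^sub>R p)
            + (h - 4 * \<rho> * k) * (q p P - (1 - \<rho>) / 2 * q p p)"
        unfolding A_def B_def C_def Gx Gxp Xp step alg \<rho>_def
          inner_product_commute[OF q, of P p] inner_product_commute[OF q, of X p]
          inner_product_commute[OF q, of P X]
        by (simp add: field_simps)
      moreover have "h - 4 * \<rho> * k = 0"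
        using hk by simp
      ultimately show ?thesis
        by simp
    qed
    moreover have "0 \<le> k * q (P + \<rho> *\<^sub>R p) (P + \<rho> *\<^sub>R p)"
      using \<open>0 < k\<close> by (simp add: inner_product_nonneg[OF q])
    ultimately have "f xp - f xstar \<le> \<rho>\<^sup>2 * (f x - f xstar)"
      by (simp add: power2_eq_square algebra_simps)
    then show ?thesis
      by (simp add: xp_def \<rho>_def)
  qed
qed

section \<open>Every search direction is a gradient\<close>

text \<open>
  For \<open>a \<noteq> b\<close> this is the Householder reflection in the hyperplane orthogonal to \<open>a - b\<close>, which
  contains \<open>(a + b) / 2\<close> because \<open>a\<close> and \<open>b\<close> have equal norms.
\<close>

lemma reflection_exists:
  fixes ip :: "'a::real_vector \<Rightarrow> 'a \<Rightarrow> real"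
  assumes ip: "inner_product ip" and eq: "ip a a = ip b b"
  obtains R where "linear R" "R a = b" "\<And>u. R (R u) = u" "\<And>u v. ip (R u) v = ip u (R v)"
proof (cases "a = b")
  case True
  then show ?thesis
    by (intro that[of "\<lambda>u. u"]) (simp_all add: linear_ident)
next
  case False
  note alg = inner_product_algebra[OF ip]
  define c where "c = a - b"
  have pos: "0 < ip c c"
    using False by (simp add: c_def inner_product_pos[OF ip])
  define R where "R u = u - (2 * ip u c / ip c c) *\<^sub>R c" for u
  show ?thesis
  proof (rule that[of R])
    show "linear R"
      by (rule linearI) (simp_all add: R_def alg algebra_simps add_divide_distrib)
    have "2 * ip a c = ip c c"
      using eq by (simp add: c_def alg inner_product_commute[OF ip, of b a])
    then show "R a = b"
      using pos by (simp add: R_def c_def)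
    show "R (R u) = u" for u
      using pos by (simp add: R_def alg algebra_simps)
    show "ip (R u) v = ip u (R v)" for u v
      by (simp add: R_def alg inner_product_commute[OF ip, of c v])
  qed
qed

text \<open>
  Since \<open>R\<close> is an involution, \<open>(I + s R) (I - s R) = (1 - s\<^sup>2) I\<close>, so the inverse of
  \<open>B = (r / cos \<theta>) (I + sin \<theta> R)\<close> is \<open>(I - sin \<theta> R) / (r cos \<theta>)\<close>.  For \<open>\<theta> = 0\<close> the reflection
  maps \<open>0\<close> to \<open>0\<close> and \<open>B\<close> is a multiple of the identity.
\<close>

lemma preconditioned_inner_product:
  fixes ip :: "'a::real_vector \<Rightarrow> 'a \<Rightarrow> real"
  assumes ip: "inner_product ip" and "0 < r" and norm_d: "ip_norm ip d = r * ip_norm ip g"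
    and "0 \<le> \<theta>" and "\<theta> < pi / 2"
    and angle: "ip g d = cos \<theta> * ip_norm ip g * ip_norm ip d"
  obtains q B where "inner_product q" "\<And>u v. q (B u) v = ip u v" "B g = d"
    "\<And>v. r * (1 - sin \<theta>) / cos \<theta> * q v v \<le> ip v v"
    "\<And>v. ip v v \<le> r * (1 + sin \<theta>) / cos \<theta> * q v v"
proof -
  note alg = inner_product_algebra[OF ip]
  define s where "s = sin \<theta>"
  define c where "c = cos \<theta>"
  have "0 < c"
    unfolding c_def using \<open>0 \<le> \<theta>\<close> \<open>\<theta> < pi / 2\<close> by (intro cos_gt_zero_pi) auto
  have "0 \<le> s"
    unfolding s_def using \<open>0 \<le> \<theta>\<close> \<open>\<theta> < pi / 2\<close> by (intro sin_ge_zero) auto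
  have sc: "s * s = 1 - c * c"
    using sin_cos_squared_add[of \<theta>] by (simp add: s_def c_def power2_eq_square)
  then have factor: "(1 - s) * (1 + s) = c * c"
    by (simp add: algebra_simps)
  have "s\<^sup>2 < 1\<^sup>2"
    using sc \<open>0 < c\<close> by (simp add: power2_eq_square)
  then have "s < 1"
    by (rule power_less_imp_less_base) simp
  have gd: "ip g d = c * r * ip g g"
    unfolding angle norm_d c_def by (simp add: power2_eq_square flip: ip_norm_power2[OF ip])
  have dd: "ip d d = r * r * ip g g"
    unfolding ip_norm_power2[OF ip, symmetric] norm_d by (simp add: power2_eq_square)
  define w where "w = (c / r) *\<^sub>R d - g"
  have "ip (s *\<^sub>R g) (s *\<^sub>R g) = ip w w"
    using \<open>0 < r\<close> sc
    by (simp add: w_def alg inner_product_commute[OF ip, of d g] gd dd flip: mult.assoc)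
       (simp add: algebra_simps)
  then obtain R where R: "linear R" "R (s *\<^sub>R g) = w" "\<And>u. R (R u) = u"
      "\<And>u v. ip (R u) v = ip u (R v)"
    by (rule reflection_exists[OF ip]) blast
  have Radd: "R (u + v) = R u + R v" and Rscale: "R (a *\<^sub>R u) = a *\<^sub>R R u" for u v a
    using R(1) by (simp_all add: linear_add linear_scale)
  have Rbound: "\<bar>ip (R v) v\<bar> \<le> ip v v" for v
  proof -
    have "0 \<le> ip (v + R v) (v + R v)" "0 \<le> ip (v - R v) (v - R v)"
      by (rule inner_product_nonneg[OF ip])+
    moreover have "ip (R v) (R v) = ip v v"
      by (simp add: R(3,4))
    ultimately show ?thesis
      by (simp add: alg inner_product_commute[OF ip, of v "R v"] abs_le_iff)
  qed
  define q where "q u v = ip (u - s *\<^sub>R R u) v / (r * c)" for u v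
  define B where "B u = (r / c) *\<^sub>R (u + s *\<^sub>R R u)" for u
  have qvv: "q v v * (r * c) = ip v v - s * ip (R v) v" for v
    using \<open>0 < r\<close> \<open>0 < c\<close> by (simp add: q_def alg)
  have sR: "\<bar>s * ip (R v) v\<bar> \<le> s * ip v v" for v
    using Rbound[of v] \<open>0 \<le> s\<close> by (simp add: abs_mult mult_left_mono)
  have q_le: "(1 - s) * ip v v \<le> q v v * (r * c)" "q v v * (r * c) \<le> (1 + s) * ip v v" for v
    using sR[of v] unfolding qvv by (simp_all add: abs_le_iff algebra_simps)
  show ?thesis
  proof (rule that[of q B])
    show "inner_product q"
      unfolding inner_product_def bilinear_def
    proof (intro conjI allI impI)
      show "linear (q u)" for u
        by (rule linearI) (simp_all add: q_def alg add_divide_distrib)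
      show "linear (\<lambda>u. q u v)" for v
        by (rule linearI) (simp_all add: q_def alg Radd Rscale algebra_simps add_divide_distrib diff_divide_distrib)
      show "q u v = q v u" for u v
        by (simp add: q_def alg R(4) inner_product_commute[OF ip, of u v]
            inner_product_commute[OF ip, of u "R v"])
      show "0 < q v v" if "v \<noteq> 0" for v
      proof -
        have "0 < (1 - s) * ip v v"
          using \<open>s < 1\<close> inner_product_pos[OF ip that] by simp
        then have "0 < q v v * (r * c)"
          using q_le(1)[of v] by linarith
        then show ?thesis
          by (rule zero_less_mult_pos2) (use \<open>0 < r\<close> \<open>0 < c\<close> in simp)
      qed
    qed
    show "q (B u) v = ip u v" for u v
    proof -
      have "B u - s *\<^sub>R R (B u) = (r / c * (1 - s * s)) *\<^sub>R u"
        by (simp add: B_def Radd Rscale R(3) algebra_simps)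
      also have "r / c * (1 - s * s) = r * c"
        using \<open>0 < c\<close> by (simp add: sc)
      finally show ?thesis
        using \<open>0 < r\<close> \<open>0 < c\<close> by (simp add: q_def alg)
    qed
    show "B g = d"
      using R(2) \<open>0 < r\<close> \<open>0 < c\<close> by (simp add: B_def Rscale w_def)
    show "r * (1 - sin \<theta>) / cos \<theta> * q v v \<le> ip v v" for v
    proof -
      have "(1 - s) * (q v v * (r * c)) \<le> (1 - s) * ((1 + s) * ip v v)"
        using q_le(2)[of v] \<open>s < 1\<close> by (intro mult_left_mono) auto
      also have "\<dots> = c * c * ip v v"
        by (simp add: factor flip: mult.assoc)
      finally have "c * ((1 - s) * (q v v * r)) \<le> c * (c * ip v v)"
        by (simp add: mult_ac)
      then have "(1 - s) * (q v v * r) \<le> c * ip v v"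
        using \<open>0 < c\<close> by simp
      then show ?thesis
        using \<open>0 < c\<close> by (simp add: field_simps flip: s_def c_def)
    qed
    show "ip v v \<le> r * (1 + sin \<theta>) / cos \<theta> * q v v" for v
    proof -
      have "c * c * ip v v = (1 + s) * ((1 - s) * ip v v)"
        by (simp add: mult_ac flip: factor)
      also have "\<dots> \<le> (1 + s) * (q v v * (r * c))"
        using q_le(1)[of v] \<open>0 \<le> s\<close> by (intro mult_left_mono) auto
      finally have "c * (c * ip v v) \<le> c * ((1 + s) * (q v v * r))"
        by (simp add: mult_ac)
      then have "c * ip v v \<le> (1 + s) * (q v v * r)"
        using \<open>0 < c\<close> by simp
      then show ?thesis
        using \<open>0 < c\<close> by (simp add: field_simps flip: s_def c_def)
    qed
  qed
qed

section \<open>The convergence rate\<close>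

text \<open>
  The interval of admissible eigenvalues is widest for the largest angle.  For the lower end this
  is read off from \<open>(1 - sin \<theta>) / cos \<theta> = cos \<theta> / (1 + sin \<theta>)\<close>.
\<close>

lemma angle_factor_mono:
  fixes \<theta> \<theta>' :: real
  assumes "0 \<le> \<theta>" and "\<theta> \<le> \<theta>'" and "\<theta>' < pi / 2"
  shows "(1 + sin \<theta>) / cos \<theta> \<le> (1 + sin \<theta>') / cos \<theta>'"
    and "(1 - sin \<theta>') / cos \<theta>' \<le> (1 - sin \<theta>) / cos \<theta>"
proof -
  have sin: "0 \<le> sin \<theta>" "sin \<theta> \<le> sin \<theta>'"
    using assms by (auto intro!: sin_ge_zero sin_monotone_2pi_le)
  have cos: "0 < cos \<theta>'" "cos \<theta>' \<le> cos \<theta>"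
    using assms by (auto intro!: cos_gt_zero_pi cos_monotone_0_pi_le)
  show "(1 + sin \<theta>) / cos \<theta> \<le> (1 + sin \<theta>') / cos \<theta>'"
    using sin cos by (intro frac_le) auto
  have flip: "(1 - sin t) / cos t = cos t / (1 + sin t)" if "0 < cos t" "0 \<le> sin t" for t :: real
    using that sin_cos_squared_add[of t]
    by (simp add: frac_eq_eq power2_eq_square algebra_simps)
  have "cos \<theta>' / (1 + sin \<theta>') \<le> cos \<theta> / (1 + sin \<theta>)"
    using sin cos by (intro frac_le) auto
  then show "(1 - sin \<theta>') / cos \<theta>' \<le> (1 - sin \<theta>) / cos \<theta>"
    using sin cos by (simp add: flip)
qed

theorem theorem3p4:
  fixes ip :: "real ^ 'n \<Rightarrow> real ^ 'n \<Rightarrow> real"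
    and f :: "real ^ 'n \<Rightarrow> real"
    and x xstar d :: "real ^ 'n"
    and L \<mu> \<theta> \<theta>' c\<^sub>1 c\<^sub>2 hbar \<kappa>' :: real
  assumes "inner_product ip"
    and "0 < \<mu>" and "\<mu> \<le> L"
    and "smooth_wrt ip L f"
    and "strongly_convex_wrt ip \<mu> f"
    and "is_arg_min f (\<lambda>_. True) xstar"
    and "0 \<le> \<theta>" and "\<theta> < pi / 2"
    and "ip (gradient ip f x) d = cos \<theta> * ip_norm ip (gradient ip f x) * ip_norm ip d"
    and "0 < c\<^sub>1" and "c\<^sub>1 \<le> c\<^sub>2"
    and "0 \<le> \<theta>'" and "\<theta>' < pi / 2"
    and "\<theta> \<le> \<theta>'"
    and "c\<^sub>1 * ip_norm ip (gradient ip f x) \<le> ip_norm ip d"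
    and "ip_norm ip d \<le> c\<^sub>2 * ip_norm ip (gradient ip f x)"
    and hbar_def: "hbar = 2 * cos \<theta>' / (L * c\<^sub>2 * (1 + sin \<theta>') + \<mu> * c\<^sub>1 * (1 - sin \<theta>'))"
    and kappa_def: "\<kappa>' = L / \<mu> * (c\<^sub>2 / c\<^sub>1) * ((1 + sin \<theta>') / (1 - sin \<theta>'))"
  shows "(\<forall>h. 0 \<le> h \<and> h \<le> hbar \<longrightarrow>
            f (x - h *\<^sub>R d) - f xstar
              \<le> (1 - h * \<mu> * c\<^sub>1 * (1 - sin \<theta>') / cos \<theta>')\<^sup>2 * (f x - f xstar)) \<and>
         f (x - hbar *\<^sub>R d) - f xstar \<le> ((\<kappa>' - 1) / (\<kappa>' + 1))\<^sup>2 * (f x - f xstar)"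
proof -
  note ip = \<open>inner_product ip\<close>
  define m where "m = \<mu> * (c\<^sub>1 * ((1 - sin \<theta>') / cos \<theta>'))"
  define M where "M = L * (c\<^sub>2 * ((1 + sin \<theta>') / cos \<theta>'))"
  have sin': "0 \<le> sin \<theta>'"
    using \<open>0 \<le> \<theta>'\<close> \<open>\<theta>' < pi / 2\<close> by (intro sin_ge_zero) auto
  have cos': "0 < cos \<theta>'"
    using \<open>0 \<le> \<theta>'\<close> \<open>\<theta>' < pi / 2\<close> by (intro cos_gt_zero_pi) auto
  have "(sin \<theta>')\<^sup>2 < 1\<^sup>2"
    using sin_cos_squared_add[of \<theta>'] cos' by (simp add: sin_squared_eq)
  then have sin'_less: "sin \<theta>' < 1"
    by (rule power_less_imp_less_base) simp
  have "0 < m"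
    using \<open>0 < \<mu>\<close> \<open>0 < c\<^sub>1\<close> cos' sin'_less by (simp add: m_def)
  have "m \<le> M"
    unfolding m_def M_def
    using \<open>0 < \<mu>\<close> \<open>\<mu> \<le> L\<close> \<open>0 < c\<^sub>1\<close> \<open>c\<^sub>1 \<le> c\<^sub>2\<close> cos' sin' sin'_less
    by (intro mult_mono divide_right_mono) auto
  have rate: "1 - h * \<mu> * c\<^sub>1 * (1 - sin \<theta>') / cos \<theta>' = 1 - h * m" for h
    by (simp add: m_def)
  have "M + m = (L * c\<^sub>2 * (1 + sin \<theta>') + \<mu> * c\<^sub>1 * (1 - sin \<theta>')) / cos \<theta>'"
    using cos' by (simp add: m_def M_def field_simps)
  then have hbar: "hbar = 2 / (M + m)"
    by (simp add: hbar_def)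
  have kappa: "\<kappa>' = M / m"
    using cos' \<open>0 < \<mu>\<close> \<open>0 < c\<^sub>1\<close> sin'_less by (simp add: kappa_def m_def M_def)
  have min: "f xstar \<le> f y" for y
    using \<open>is_arg_min f (\<lambda>_. True) xstar\<close> by (auto simp: is_arg_min_def not_less)
  let ?g = "gradient ip f x"
  have lower: "f y + ip (gradient ip f y) (z - y) + \<mu> / 2 * ip (z - y) (z - y) \<le> f z" for y z
    using \<open>strongly_convex_wrt ip \<mu> f\<close> by (simp add: strongly_convex_wrt_def ip_norm_power2[OF ip])
  note upper = smooth_wrt_quadratic_upper_bound[OF ip \<open>smooth_wrt ip L f\<close>]
  have main: "f (x - h *\<^sub>R d) - f xstar \<le> (1 - h * m)\<^sup>2 * (f x - f xstar)"
    if h: "0 \<le> h" "h \<le> hbar" for h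
  proof (cases "?g = 0")
    case True
    then have "ip_norm ip d \<le> 0"
      using \<open>ip_norm ip d \<le> c\<^sub>2 * ip_norm ip ?g\<close> by (simp add: ip_norm_eq_0_iff[OF ip, THEN iffD2])
    then have "d = 0"
      using ip_norm_nonneg[OF ip, of d] ip_norm_eq_0_iff[OF ip, of d] by simp
    have "f x + \<mu> / 2 * ip (xstar - x) (xstar - x) \<le> f xstar"
      using lower[of x xstar] True by (simp add: inner_product_algebra[OF ip])
    moreover have "0 \<le> \<mu> / 2 * ip (xstar - x) (xstar - x)"
      using \<open>0 < \<mu>\<close> by (simp add: inner_product_nonneg[OF ip])
    ultimately have "f x = f xstar"
      using min[of x] by linarith
    with \<open>d = 0\<close> show ?thesis by simp
  next
    case False
    then have g_pos: "0 < ip_norm ip ?g"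
      using ip_norm_nonneg[OF ip, of ?g] ip_norm_eq_0_iff[OF ip, of ?g] by linarith
    define r where "r = ip_norm ip d / ip_norm ip ?g"
    have r: "c\<^sub>1 \<le> r" "r \<le> c\<^sub>2"
      using \<open>c\<^sub>1 * ip_norm ip ?g \<le> ip_norm ip d\<close> \<open>ip_norm ip d \<le> c\<^sub>2 * ip_norm ip ?g\<close> g_pos
      by (simp_all add: r_def field_simps)
    have "0 < r" and norm_d: "ip_norm ip d = r * ip_norm ip ?g"
      using r \<open>0 < c\<^sub>1\<close> g_pos by (simp_all add: r_def)
    obtain q B where q: "inner_product q" and qB: "\<And>u v. q (B u) v = ip u v" and Bg: "B ?g = d"
      and q_low: "\<And>v. r * (1 - sin \<theta>) / cos \<theta> * q v v \<le> ip v v"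
      and q_up: "\<And>v. ip v v \<le> r * (1 + sin \<theta>) / cos \<theta> * q v v"
      using preconditioned_inner_product[OF ip \<open>0 < r\<close> norm_d \<open>0 \<le> \<theta>\<close> \<open>\<theta> < pi / 2\<close>
          \<open>ip ?g d = cos \<theta> * ip_norm ip ?g * ip_norm ip d\<close>] by blast
    note mono = angle_factor_mono[OF \<open>0 \<le> \<theta>\<close> \<open>\<theta> \<le> \<theta>'\<close> \<open>\<theta>' < pi / 2\<close>]
    have m_low: "m / 2 * q v v \<le> \<mu> / 2 * ip v v" for v
    proof -
      have "c\<^sub>1 * ((1 - sin \<theta>') / cos \<theta>') \<le> r * ((1 - sin \<theta>) / cos \<theta>)"
        using mono(2) r \<open>0 < r\<close> cos' sin'_less by (intro mult_mono) auto
      then have "c\<^sub>1 * ((1 - sin \<theta>') / cos \<theta>') * q v v \<le> r * ((1 - sin \<theta>) / cos \<theta>) * q v v"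
        by (intro mult_right_mono inner_product_nonneg[OF q])
      also have "\<dots> \<le> ip v v"
        using q_low[of v] by simp
      finally have "\<mu> / 2 * (c\<^sub>1 * ((1 - sin \<theta>') / cos \<theta>') * q v v) \<le> \<mu> / 2 * ip v v"
        using \<open>0 < \<mu>\<close> by (intro mult_left_mono) auto
      then show ?thesis
        by (simp add: m_def mult_ac)
    qed
    have M_up: "L / 2 * ip v v \<le> M / 2 * q v v" for v
    proof -
      have "r * ((1 + sin \<theta>) / cos \<theta>) \<le> c\<^sub>2 * ((1 + sin \<theta>') / cos \<theta>')"
        using mono(1) r \<open>0 < r\<close> \<open>0 \<le> \<theta>\<close> \<open>\<theta> < pi / 2\<close>
        by (intro mult_mono divide_nonneg_nonneg add_nonneg_nonneg sin_ge_zero cos_ge_zero) auto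
      then have "r * ((1 + sin \<theta>) / cos \<theta>) * q v v \<le> c\<^sub>2 * ((1 + sin \<theta>') / cos \<theta>') * q v v"
        by (intro mult_right_mono inner_product_nonneg[OF q])
      then have "ip v v \<le> c\<^sub>2 * ((1 + sin \<theta>') / cos \<theta>') * q v v"
        using q_up[of v] by simp
      then have "L / 2 * ip v v \<le> L / 2 * (c\<^sub>2 * ((1 + sin \<theta>') / cos \<theta>') * q v v)"
        using \<open>0 < \<mu>\<close> \<open>\<mu> \<le> L\<close> by (intro mult_left_mono) auto
      then show ?thesis
        by (simp add: M_def mult_ac)
    qed
    have "f (x - h *\<^sub>R B ?g) - f xstar \<le> (1 - h * m)\<^sup>2 * (f x - f xstar)"
    proof (rule gradient_step_contraction[OF q \<open>0 < m\<close> \<open>m \<le> M\<close>, where G = "\<lambda>y. B (gradient ip f y)"])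
      fix y z
      show "f y + q (B (gradient ip f y)) (z - y) + m / 2 * q (z - y) (z - y) \<le> f z"
        using lower[of y z] m_low[of "z - y"] by (simp only: qB)
      show "f z \<le> f y + q (B (gradient ip f y)) (z - y) + M / 2 * q (z - y) (z - y)"
        using upper[of z y] M_up[of "z - y"] by (simp only: qB)
    qed (use min h hbar in auto)
    then show ?thesis
      by (simp only: Bg)
  qed
  have "0 \<le> hbar"
    using \<open>0 < m\<close> \<open>m \<le> M\<close> by (simp add: hbar)
  have "\<kappa>' - 1 = (M - m) / m" and "\<kappa>' + 1 = (M + m) / m"
    using \<open>0 < m\<close> by (simp_all add: kappa diff_divide_distrib add_divide_distrib)
  then have "(\<kappa>' - 1) / (\<kappa>' + 1) = (M - m) / (M + m)"
    using \<open>0 < m\<close> by simp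
  also have "\<dots> = 1 - hbar * m"
    using \<open>0 < m\<close> \<open>m \<le> M\<close> by (simp add: hbar field_simps)
  finally have "(\<kappa>' - 1) / (\<kappa>' + 1) = 1 - hbar * m" .
  then show ?thesis
    using main \<open>0 \<le> hbar\<close> by (simp add: rate)
qed

end
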